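(* There is an absolute constant $C$ such that the following holds. Let $n \geq 1$ be an integer and let $\psi$ be a differentiable function on $\mathbf{R}$ having $n$ vanishing moments, that is, $$\int_{-\infty}^{\infty} x^k \psi(x)\,dx = 0 \qquad (0 \leq k < n).$$ Assume also that $\|\psi\|_{1,\infty}$, $\|x^{n+1}\psi(\cdot)\|_{1,\infty}$ and $\|x^n \psi(\cdot)\|_1$ are finite. Then the Hilbert transform $\mathcal{H}\psi(x)$ is well-defined at every $x \in \mathbf{R}$ (i.e. the limit defining it exists), and for all $x \in \mathbf{R}$, $$|\mathcal{H}\psi(x)| \leq \frac{C}{1+|x|^{n+1}} \Big( \|\psi\|_{1,\infty} + \|x^{n+1}\psi(\cdot)\|_{1,\infty} + \|x^n\psi(\cdot)\|_1 \Big);$$ in particular $\mathcal{H}\psi(x) = O(|x|^{-n-1})$. Moreover, $\mathcal{H}\psi$ has $n$ vanishing moments, that is, $$\int_{-\infty}^{\infty} x^k\, \mathcal{H}\psi(x)\,dx = 0 \qquad (0 \leq k < n).$$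
   Context: Functions are complex-valued functions on $\mathbf{R}$. The Hilbert transform of $f$ is defined pointwise by $$\mathcal{H}f(x) = \frac{1}{\pi} \lim_{\varepsilon \to 0^+} \int_{|t|>\varepsilon} f(x-t)\,\frac{dt}{t}.$$ Norms: $\|f\|_1 = \int_{-\infty}^{\infty} |f(x)|\,dx$, $\|f\|_\infty = \sup\{|f(x)| : x \in \mathbf{R}\}$, and for differentiable $f$, $\|f\|_{1,\infty} = \|f\|_1 + \|f'\|_\infty$. For an integer $m \geq 0$, $x^m\psi(\cdot)$ denotes the function $x \mapsto x^m\psi(x)$. A function $f$ has $n$ vanishing moments if $\int_{-\infty}^{\infty} x^k f(x)\,dx = 0$ for all integers $0 \leq k < n$ (the integrals being absolutely convergent). The constant $C$ does not depend on $\psi$, $n$ or $x$. *)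

theory Defs
  imports "HOL-Analysis.Analysis" "HOL-Library.Landau_Symbols"
begin

text \<open>The norms take values in the extended nonnegative reals, so that finiteness is the
  statement \<open>< \<infinity>\<close> and no norm is silently given a junk value.\<close>

definition norm_L1 :: "(real \<Rightarrow> complex) \<Rightarrow> ennreal" where
  "norm_L1 f = (\<integral>\<^sup>+ x. ennreal (cmod (f x)) \<partial>lborel)"

definition norm_sup :: "(real \<Rightarrow> complex) \<Rightarrow> ennreal" where
  "norm_sup f = (SUP x. ennreal (cmod (f x)))"

text \<open>Only meaningful for functions \<open>f\<close> that are differentiable on the whole line.\<close>

definition norm_1inf :: "(real \<Rightarrow> complex) \<Rightarrow> ennreal" where
  "norm_1inf f = norm_L1 f + norm_sup (\<lambda>x. vector_derivative f (at x))"

definition times_pow :: "nat \<Rightarrow> (real \<Rightarrow> complex) \<Rightarrow> real \<Rightarrow> complex" where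
  "times_pow m f = (\<lambda>x. of_real (x ^ m) * f x)"

definition vanishing_moments :: "nat \<Rightarrow> (real \<Rightarrow> complex) \<Rightarrow> bool" where
  "vanishing_moments n f \<longleftrightarrow>
     (\<forall>k<n. integrable lborel (times_pow k f) \<and> (LINT x|lborel. times_pow k f x) = 0)"

definition hilbert_truncated :: "(real \<Rightarrow> complex) \<Rightarrow> real \<Rightarrow> real \<Rightarrow> complex" where
  "hilbert_truncated f x \<epsilon> = (LINT t:{t. \<bar>t\<bar> > \<epsilon>}|lborel. f (x - t) / of_real t)"

text \<open>Besides the existence of the limit, well-definedness asks that the truncated integrals
  converge absolutely, since the Bochner integral of a non-integrable function is 0 by
  convention.\<close>

definition hilbert_well_defined :: "(real \<Rightarrow> complex) \<Rightarrow> real \<Rightarrow> bool" where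
  "hilbert_well_defined f x \<longleftrightarrow>
     (\<forall>\<epsilon>>0. set_integrable lborel {t. \<bar>t\<bar> > \<epsilon>} (\<lambda>t. f (x - t) / of_real t)) \<and>
     (\<exists>L. (hilbert_truncated f x \<longlongrightarrow> L) (at_right 0))"

definition hilbert :: "(real \<Rightarrow> complex) \<Rightarrow> real \<Rightarrow> complex" where
  "hilbert f x = of_real (1 / pi) * Lim (at_right 0) (hilbert_truncated f x)"

end

theory Submission
  imports Defs "HOL-Probability.Sinc_Integral"
begin

text \<open>
  Write \<open>T\<^sub>\<epsilon> f\<close> for the truncated integral, so that \<open>\<pi> H f\<close> is the limit of \<open>T\<^sub>\<epsilon> f\<close>.

  For an integrable Lipschitz function \<open>f\<close>, the kernel \<open>1/t\<close> is odd, so subtracting the constant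
  \<open>f x\<close> on \<open>\<epsilon> < \<bar>t\<bar> \<le> 1\<close> does not change \<open>T\<^sub>\<epsilon> f x\<close>. The new integrand is bounded near \<open>0\<close> by
  the Lipschitz constant \<open>L\<close> and away from \<open>0\<close> by \<open>\<bar>f (x - t)\<bar>\<close>. Hence the limit exists and has
  modulus at most \<open>2 L + \<parallel>f\<parallel>\<^sub>1\<close>, uniformly in \<open>x\<close> and \<open>\<epsilon> \<le> 1\<close> (\<open>hilbert_truncated_bound\<close>,
  \<open>hilbert_truncated_tendsto\<close>).

  Decay comes from commuting \<open>H\<close> with powers of the variable. Since \<open>x^m - y^m\<close> is divisible by
  \<open>x - y\<close>, the difference between \<open>x^m H f x\<close> and \<open>H (y^m f) x\<close> is a polynomial in \<open>x\<close> whose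
  coefficients are multiples of the moments of \<open>f\<close> of order below \<open>m\<close> (\<open>hilbert_times_pow\<close>). For \<open>m = n + 1\<close>
  only the moment of order \<open>n\<close> survives, and the uniform bound applied to \<open>\<psi>\<close> and to
  \<open>x^(n+1) \<psi>\<close> gives the estimate, with \<open>C = 1\<close> because \<open>2 \<le> \<pi>\<close>.

  For \<open>k < n\<close> all the moments involved vanish, so \<open>x^k H \<psi> = H (x^k \<psi>)\<close>, and the last claim
  reduces to \<open>\<integral> H f = 0\<close> for \<open>f = x^k \<psi>\<close>. Formally \<open>\<integral> H f \<cdot> w = - \<integral> f \<cdot> H w\<close>, and \<open>H 1 = 0\<close>.
  To make this rigorous, take \<open>w x = 1 / (1 + (x/R)^2)\<close>. At the level of \<open>T\<^sub>\<epsilon>\<close> the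
  antisymmetry is Fubini's theorem (\<open>hilbert_truncated_antisymmetric\<close>), and \<open>w\<close> has the virtue that
  \<open>\<bar>T\<^sub>\<epsilon> w y\<bar> \<le> 2 \<pi> \<bar>y\<bar> / R\<close> for every \<open>\<epsilon>\<close>. As \<open>y f\<close> is integrable, letting \<open>\<epsilon> \<rightarrow> 0\<close> and then
  \<open>R \<rightarrow> \<infinity>\<close> gives the claim (\<open>hilbert_integral_eq_0\<close>). This needs \<open>x^k \<psi>\<close> to be Lipschitz,
  which is interpolated from the two ends \<open>0\<close> and \<open>n + 1\<close> (\<open>times_pow_lipschitz\<close>).
\<close>

section \<open>Truncated integrals\<close>

lemma hilbert_truncated_eq:
  "hilbert_truncated f x \<epsilon> = (LINT t|lborel. indicator {t. \<bar>t\<bar> > \<epsilon>} t *\<^sub>R (f (x - t) / of_real t))"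
  by (simp add: hilbert_truncated_def set_lebesgue_integral_def)

lemma integrable_affine_iff:
  fixes f :: "real \<Rightarrow> complex"
  assumes "\<bar>c\<bar> = 1"
  shows "integrable lborel (\<lambda>t. f (x + c * t)) \<longleftrightarrow> integrable lborel f"
  using lborel_integrable_real_affine_iff[of c f x] assms by auto

lemma integral_affine:
  fixes f :: "real \<Rightarrow> 'a::{banach,second_countable_topology}"
  assumes "\<bar>c\<bar> = 1"
  shows "(LINT t|lborel. f (x + c * t)) = (LINT t|lborel. f t)"
  using lborel_integral_real_affine[of c f x] assms by auto

lemma integrable_reflect:
  fixes f :: "real \<Rightarrow> complex"
  assumes "integrable lborel f"
  shows "integrable lborel (\<lambda>t. f (x - t))"
  using integrable_affine_iff[of "-1" f x] assms by simp

lemma integral_reflect: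
  fixes f :: "real \<Rightarrow> 'a::{banach,second_countable_topology}"
  shows "(LINT t|lborel. f (x - t)) = (LINT t|lborel. f t)"
  using integral_affine[of "-1" f x] by simp

text \<open>Dominated convergence; the point \<open>t = 0\<close>, which no truncation covers, is a null set.\<close>
lemma truncation_limit:
  fixes g :: "real \<Rightarrow> complex"
  assumes "integrable lborel g"
  shows "((\<lambda>\<epsilon>. LINT t|lborel. indicator {t. \<bar>t\<bar> > \<epsilon>} t *\<^sub>R g t) \<longlongrightarrow> (LINT t|lborel. g t)) (at_right 0)"
  unfolding filterlim_at_right_to_top
proof (rule integral_dominated_convergence_at_top[where w = "\<lambda>t. cmod (g t)"])
  have [measurable]: "g \<in> borel_measurable lborel" using assms by simp
  show "g \<in> borel_measurable lborel" "integrable lborel (\<lambda>t. cmod (g t))"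
    using assms by auto
  show "(\<lambda>t. indicator {t. \<bar>t\<bar> > inverse s} t *\<^sub>R g t) \<in> borel_measurable lborel" for s
    by measurable
  show "\<forall>\<^sub>F s in at_top. AE t in lborel. norm (indicator {t. \<bar>t\<bar> > inverse s} t *\<^sub>R g t) \<le> cmod (g t)"
    by (intro always_eventually allI AE_I2) (simp add: indicator_def)
  have "((\<lambda>s. indicator {t. \<bar>t\<bar> > inverse s} t *\<^sub>R g t) \<longlongrightarrow> g t) at_top" if "t \<noteq> 0" for t
  proof (rule tendsto_eventually)
    have "\<forall>\<^sub>F s in at_top. s > inverse \<bar>t\<bar>" by (rule eventually_gt_at_top)
    then show "\<forall>\<^sub>F s in at_top. indicator {t. \<bar>t\<bar> > inverse s} t *\<^sub>R g t = g t"
    proof eventually_elim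
      case (elim s)
      then have "inverse s < \<bar>t\<bar>"
        using that less_imp_inverse_less[OF elim] by simp
      then show ?case by simp
    qed
  qed
  then show "AE t in lborel. ((\<lambda>s. indicator {t. \<bar>t\<bar> > inverse s} t *\<^sub>R g t) \<longlongrightarrow> g t) at_top"
    using AE_lborel_singleton[of "0::real"] by auto
qed

lemma truncated_integrable:
  fixes f :: "real \<Rightarrow> complex"
  assumes "integrable lborel f" "\<epsilon> > 0"
  shows "set_integrable lborel {t. \<bar>t\<bar> > \<epsilon>} (\<lambda>t. f (x - t) / of_real t)"
  unfolding set_integrable_def
proof (rule Bochner_Integration.integrable_bound)
  note [measurable] = borel_measurable_integrable[OF integrable_reflect[OF assms(1), of x]]
  show "integrable lborel (\<lambda>t. f (x - t) /\<^sub>R \<epsilon>)"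
    using integrable_reflect[OF assms(1)] by simp
  show "(\<lambda>t. indicator {t. \<bar>t\<bar> > \<epsilon>} t *\<^sub>R (f (x - t) / complex_of_real t)) \<in> borel_measurable lborel"
    by measurable
  show "AE t in lborel. norm (indicator {t. \<bar>t\<bar> > \<epsilon>} t *\<^sub>R (f (x - t) / complex_of_real t))
      \<le> norm (f (x - t) /\<^sub>R \<epsilon>)"
    using assms(2)
    by (intro AE_I2) (auto simp: indicator_def norm_mult norm_inverse divide_inverse mult.commute[of "inverse \<epsilon>"]
        intro!: mult_left_mono le_imp_inverse_le)
qed

section \<open>Existence of the limit and a uniform bound\<close>

text \<open>The absolutely convergent integrand that replaces the principal value: its integral over the
  whole line is \<open>\<pi> H f x\<close>. At \<open>t = 0\<close> the division yields \<open>0\<close>.\<close>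
definition hilbert_integrand :: "(real \<Rightarrow> complex) \<Rightarrow> real \<Rightarrow> real \<Rightarrow> complex" where
  "hilbert_integrand f x t = (f (x - t) - indicator {-1..1} t *\<^sub>R f x) / of_real t"

lemma
  assumes f: "integrable lborel f" and lip: "L-lipschitz_on UNIV f"
  shows hilbert_integrand_integrable: "integrable lborel (hilbert_integrand f x)"
    and hilbert_integrand_bound:
      "(LINT t|lborel. cmod (hilbert_integrand f x t)) \<le> 2 * L + (LINT t|lborel. cmod (f t))"
proof -
  note [measurable] = borel_measurable_integrable[OF integrable_reflect[OF f, of x]]
  have m[measurable]: "hilbert_integrand f x \<in> borel_measurable lborel"
    unfolding hilbert_integrand_def by measurable
  \<comment> \<open>Lipschitz bound for \<open>\<bar>t\<bar> \<le> 1\<close>, and \<open>1 / \<bar>t\<bar> < 1\<close> beyond\<close>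
  let ?w = "\<lambda>t. indicator {-1..1} t * L + cmod (f (x - t))"
  have L: "L \<ge> 0" using lip by (rule lipschitz_on_nonneg)
  have wint: "integrable lborel ?w"
    using integrable_reflect[OF f] by (intro Bochner_Integration.integrable_add) auto
  have le: "cmod (hilbert_integrand f x t) \<le> ?w t" for t
  proof (cases "\<bar>t\<bar> \<le> 1")
    case True
    have "cmod (f (x - t) - f x) \<le> L * \<bar>t\<bar>"
      using lipschitz_onD[OF lip, of "x - t" x] by (simp add: dist_norm)
    then have "cmod (f (x - t) - f x) / \<bar>t\<bar> \<le> L"
      using L by (cases "t = 0") (auto simp: divide_le_eq)
    then show ?thesis
      using True by (auto simp: hilbert_integrand_def norm_divide abs_le_iff intro: add_increasing2)
  next
    case False
    have "cmod (f (x - t)) / \<bar>t\<bar> \<le> cmod (f (x - t)) / 1"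
      using False by (intro divide_left_mono) auto
    then show ?thesis
      using False by (auto simp: hilbert_integrand_def norm_divide indicator_def abs_le_iff)
  qed
  show int: "integrable lborel (hilbert_integrand f x)"
    by (rule Bochner_Integration.integrable_bound[OF wint m]) (use le in \<open>auto intro: order_trans[OF _ abs_ge_self]\<close>)
  have "(LINT t|lborel. cmod (hilbert_integrand f x t)) \<le> (LINT t|lborel. ?w t)"
    using int wint le by (intro integral_mono) auto
  also have "\<dots> = 2 * L + (LINT t|lborel. cmod (f (x - t)))"
    using integrable_reflect[OF f] by (subst Bochner_Integration.integral_add) auto
  also have "(LINT t|lborel. cmod (f (x - t))) = (LINT t|lborel. cmod (f t))"
    by (rule integral_reflect)
  finally show "(LINT t|lborel. cmod (hilbert_integrand f x t)) \<le> 2 * L + (LINT t|lborel. cmod (f t))" .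
qed

text \<open>The integrands differ by \<open>f x / t\<close> on \<open>\<epsilon> < \<bar>t\<bar> \<le> 1\<close>, an odd function of \<open>t\<close> with
  integral \<open>0\<close>.\<close>
lemma hilbert_truncated_eq_integrand:
  assumes f: "integrable lborel f" and "0 < \<epsilon>" "\<epsilon> \<le> 1"
  shows "hilbert_truncated f x \<epsilon> =
    (LINT t|lborel. indicator {t. \<bar>t\<bar> > \<epsilon>} t *\<^sub>R hilbert_integrand f x t)"
proof -
  let ?o = "\<lambda>t. indicator {t. \<bar>t\<bar> > \<epsilon> \<and> \<bar>t\<bar> \<le> 1} t *\<^sub>R (f x / complex_of_real t)"
  have oint: "integrable lborel ?o"
  proof (rule Bochner_Integration.integrable_bound)
    show "integrable lborel (\<lambda>t. indicator {-1..1::real} t *\<^sub>R (f x / complex_of_real \<epsilon>))"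
      by simp
    show "AE t in lborel. norm (?o t) \<le> norm (indicator {-1..1} t *\<^sub>R (f x / complex_of_real \<epsilon>))"
      using assms(2) by (intro AE_I2) (auto simp: indicator_def norm_divide intro!: divide_left_mono)
  qed measurable
  have "(LINT t|lborel. ?o t) = (LINT t|lborel. ?o (0 - t))"
    by (rule integral_reflect[symmetric])
  also have "\<dots> = (LINT t|lborel. - ?o t)"
    by (rule Bochner_Integration.integral_cong) (auto simp: indicator_def)
  finally have o0: "(LINT t|lborel. ?o t) = 0"
    by (simp only: integral_minus) (simp add: equal_neg_zero)
  have eq: "indicator {t. \<bar>t\<bar> > \<epsilon>} t *\<^sub>R hilbert_integrand f x t =
     indicator {t. \<bar>t\<bar> > \<epsilon>} t *\<^sub>R (f (x - t) / complex_of_real t) - ?o t" for t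
    by (auto simp: indicator_def hilbert_integrand_def diff_divide_distrib abs_le_iff)
  show ?thesis
    unfolding eq hilbert_truncated_eq
    using truncated_integrable[OF f \<open>0 < \<epsilon>\<close>, unfolded set_integrable_def] oint o0
    by (subst Bochner_Integration.integral_diff) auto
qed

lemma hilbert_truncated_bound:
  assumes f: "integrable lborel f" and lip: "L-lipschitz_on UNIV f" and "0 < \<epsilon>" "\<epsilon> \<le> 1"
  shows "cmod (hilbert_truncated f x \<epsilon>) \<le> 2 * L + (LINT t|lborel. cmod (f t))"
proof -
  let ?g = "\<lambda>t. indicator {t. \<bar>t\<bar> > \<epsilon>} t *\<^sub>R hilbert_integrand f x t"
  note int = hilbert_integrand_integrable[OF f lip, of x]
  have [measurable]: "{t::real. \<bar>t\<bar> > \<epsilon>} \<in> sets lborel" by measurable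
  have "cmod (hilbert_truncated f x \<epsilon>) \<le> (LINT t|lborel. cmod (?g t))"
    unfolding hilbert_truncated_eq_integrand[OF f assms(3,4)] by (rule integral_norm_bound)
  also have "\<dots> \<le> (LINT t|lborel. cmod (hilbert_integrand f x t))"
    using int integrable_mult_indicator[OF _ int, of "{t. \<bar>t\<bar> > \<epsilon>}"]
    by (intro integral_mono integrable_norm) (auto simp: indicator_def)
  also note hilbert_integrand_bound[OF f lip]
  finally show ?thesis .
qed

lemma hilbert_truncated_tendsto_integrand:
  assumes f: "integrable lborel f" and lip: "L-lipschitz_on UNIV f"
  shows "(hilbert_truncated f x \<longlongrightarrow> (LINT t|lborel. hilbert_integrand f x t)) (at_right 0)"
proof (rule Lim_transform_eventually[OF truncation_limit[OF hilbert_integrand_integrable[OF f lip]]])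
  have "\<forall>\<^sub>F \<epsilon> in at_right 0. \<epsilon> \<in> {0<..<1::real}"
    by (rule eventually_at_right_real) simp
  then show "\<forall>\<^sub>F \<epsilon> in at_right 0. (LINT t|lborel. indicator {t. \<bar>t\<bar> > \<epsilon>} t *\<^sub>R hilbert_integrand f x t) =
      hilbert_truncated f x \<epsilon>"
    by eventually_elim (simp add: hilbert_truncated_eq_integrand[OF f])
qed

lemma hilbert_eqI:
  assumes "(hilbert_truncated f x \<longlongrightarrow> l) (at_right 0)"
  shows "hilbert f x = of_real (1 / pi) * l"
  unfolding hilbert_def using assms by (subst tendsto_Lim) auto

lemma hilbert_truncated_tendsto:
  assumes f: "integrable lborel f" and lip: "L-lipschitz_on UNIV f"
  shows "(hilbert_truncated f x \<longlongrightarrow> of_real pi * hilbert f x) (at_right 0)"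
  using hilbert_truncated_tendsto_integrand[OF f lip, of x]
    hilbert_eqI[OF hilbert_truncated_tendsto_integrand[OF f lip, of x]]
  by simp

lemma hilbert_well_defined_lipschitz:
  assumes f: "integrable lborel f" and lip: "L-lipschitz_on UNIV f"
  shows "hilbert_well_defined f x"
  unfolding hilbert_well_defined_def
  using truncated_integrable[OF f] hilbert_truncated_tendsto[OF f lip] by blast

lemma hilbert_bound:
  assumes f: "integrable lborel f" and lip: "L-lipschitz_on UNIV f"
  shows "pi * cmod (hilbert f x) \<le> 2 * L + (LINT t|lborel. cmod (f t))"
proof -
  have "cmod (of_real pi * hilbert f x) \<le> 2 * L + (LINT t|lborel. cmod (f t))"
  proof (rule tendsto_upperbound[OF tendsto_norm[OF hilbert_truncated_tendsto[OF f lip]]])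
    have "\<forall>\<^sub>F \<epsilon> in at_right 0. \<epsilon> \<in> {0<..<1::real}"
      by (rule eventually_at_right_real) simp
    then show "\<forall>\<^sub>F \<epsilon> in at_right 0. cmod (hilbert_truncated f x \<epsilon>) \<le> 2 * L + (LINT t|lborel. cmod (f t))"
      by eventually_elim (use hilbert_truncated_bound[OF f lip] in auto)
  qed simp
  then show ?thesis by (simp add: norm_mult)
qed

lemma hilbert_truncated_measurable:
  assumes [measurable]: "f \<in> borel_measurable borel"
  shows "(\<lambda>x. hilbert_truncated f x \<epsilon>) \<in> borel_measurable borel"
  unfolding hilbert_truncated_eq by measurable

lemma hilbert_measurable:
  assumes f: "integrable lborel f" and lip: "L-lipschitz_on UNIV f"
  shows "hilbert f \<in> borel_measurable borel"
proof (rule borel_measurable_LIMSEQ_metric)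
  show "(\<lambda>x. of_real (1 / pi) * hilbert_truncated f x (inverse (real (Suc m)))) \<in> borel_measurable borel" for m
    using hilbert_truncated_measurable[of f] f by auto
  have *: "filterlim (\<lambda>m. inverse (real (Suc m))) (at_right 0) sequentially"
    by (intro filterlim_compose[OF filterlim_inverse_at_right_top]
        filterlim_compose[OF filterlim_real_sequentially] filterlim_Suc)
  show "(\<lambda>m. of_real (1 / pi) * hilbert_truncated f x (inverse (real (Suc m)))) \<longlonglongrightarrow> hilbert f x" for x
    using tendsto_mult_left[OF filterlim_compose[OF hilbert_truncated_tendsto[OF f lip] *], of "of_real (1 / pi)" x]
    by simp
qed

section \<open>Multiplication by powers of the variable\<close>

text \<open>Put \<open>y = x - t\<close> in \<open>x^m - y^m = (x - y) * (\<Sum>j<m. x^(m - 1 - j) * y^j)\<close>: the factor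
  \<open>x - y = t\<close> cancels the kernel, and what is left are truncated moments of \<open>f\<close>.\<close>
lemma hilbert_truncated_times_pow:
  assumes f: "integrable lborel f" "integrable lborel (times_pow m f)"
    and low: "\<And>j. j < m \<Longrightarrow> integrable lborel (times_pow j f)" and "\<epsilon> > 0"
  shows "hilbert_truncated (times_pow m f) x \<epsilon> = of_real (x ^ m) * hilbert_truncated f x \<epsilon> -
    (\<Sum>j<m. of_real (x ^ (m - Suc j)) *
      (LINT t|lborel. indicator {t. \<bar>t\<bar> > \<epsilon>} t *\<^sub>R times_pow j f (x - t)))"
proof -
  let ?I = "\<lambda>t. indicat_real {t. \<bar>t\<bar> > \<epsilon>} t"
  have eq: "?I t *\<^sub>R (times_pow m f (x - t) / of_real t) =
      of_real (x ^ m) * (?I t *\<^sub>R (f (x - t) / of_real t)) -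
      (\<Sum>j<m. of_real (x ^ (m - Suc j)) * (?I t *\<^sub>R times_pow j f (x - t)))" for t
  proof (cases "\<bar>t\<bar> > \<epsilon>")
    case True
    then have t: "t \<noteq> 0" using assms(4) by auto
    have "(x - t) ^ m = x ^ m - t * (\<Sum>j<m. x ^ (m - Suc j) * (x - t) ^ j)"
      using power_diff_sumr2[of "x - t" m x] by simp
    then have "complex_of_real ((x - t) ^ m) = of_real (x ^ m) -
        of_real t * (\<Sum>j<m. of_real (x ^ (m - Suc j)) * of_real ((x - t) ^ j))"
      by (metis (no_types, lifting) of_real_diff of_real_mult of_real_sum sum.cong)
    then have "complex_of_real ((x - t) ^ m) * f (x - t) / of_real t =
        of_real (x ^ m) * (f (x - t) / of_real t) -
        (\<Sum>j<m. of_real (x ^ (m - Suc j)) * of_real ((x - t) ^ j)) * f (x - t)"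
      using t by (simp only:) (simp add: field_simps)
    then show ?thesis
      using True by (simp add: times_pow_def sum_distrib_right mult.assoc del: of_real_power)
  qed simp
  have int1: "integrable lborel (\<lambda>t. ?I t *\<^sub>R (f (x - t) / of_real t))"
    using truncated_integrable[OF f(1) assms(4)] by (simp add: set_integrable_def)
  have int2: "integrable lborel (\<lambda>t. ?I t *\<^sub>R times_pow j f (x - t))" if "j < m" for j
    using integrable_reflect[OF low[OF that], of x] by (intro integrable_mult_indicator) auto
  have int2': "integrable lborel (\<lambda>t. of_real (x ^ (m - Suc j)) * (?I t *\<^sub>R times_pow j f (x - t)))" if "j < m" for j
    by (rule integrable_mult_right) (rule int2[OF that])
  have "hilbert_truncated (times_pow m f) x \<epsilon> =
      (LINT t|lborel. of_real (x ^ m) * (?I t *\<^sub>R (f (x - t) / of_real t))) -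
      (LINT t|lborel. (\<Sum>j<m. of_real (x ^ (m - Suc j)) * (?I t *\<^sub>R times_pow j f (x - t))))"
    unfolding hilbert_truncated_eq eq
    by (intro Bochner_Integration.integral_diff Bochner_Integration.integrable_sum integrable_mult_right int1 int2) auto
  also have "(LINT t|lborel. (\<Sum>j<m. of_real (x ^ (m - Suc j)) * (?I t *\<^sub>R times_pow j f (x - t)))) =
      (\<Sum>j<m. LINT t|lborel. of_real (x ^ (m - Suc j)) * (?I t *\<^sub>R times_pow j f (x - t)))"
    by (intro Bochner_Integration.integral_sum int2') auto
  also have "\<dots> = (\<Sum>j<m. of_real (x ^ (m - Suc j)) * (LINT t|lborel. ?I t *\<^sub>R times_pow j f (x - t)))"
    by (intro sum.cong refl integral_mult_right_zero)
  finally show ?thesis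
    unfolding hilbert_truncated_eq by (simp only: integral_mult_right_zero)
qed

text \<open>As \<open>\<epsilon> \<rightarrow> 0\<close> the truncated moments become the moments.\<close>
lemma hilbert_times_pow:
  assumes f: "integrable lborel f" "L-lipschitz_on UNIV f"
    and fm: "integrable lborel (times_pow m f)"
    and low: "\<And>j. j < m \<Longrightarrow> integrable lborel (times_pow j f)"
  shows "of_real pi * hilbert (times_pow m f) x = of_real pi * of_real (x ^ m) * hilbert f x -
    (\<Sum>j<m. of_real (x ^ (m - Suc j)) * (LINT t|lborel. times_pow j f t))"
    (is "_ = ?r")
proof -
  have "((\<lambda>\<epsilon>. of_real (x ^ m) * hilbert_truncated f x \<epsilon> -
    (\<Sum>j<m. of_real (x ^ (m - Suc j)) *
      (LINT t|lborel. indicator {t. \<bar>t\<bar> > \<epsilon>} t *\<^sub>R times_pow j f (x - t))))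
    \<longlongrightarrow> of_real (x ^ m) * (of_real pi * hilbert f x) -
      (\<Sum>j<m. of_real (x ^ (m - Suc j)) * (LINT t|lborel. times_pow j f (x - t)))) (at_right 0)"
    by (intro tendsto_intros hilbert_truncated_tendsto[OF f] truncation_limit integrable_reflect low) auto
  also have "of_real (x ^ m) * (of_real pi * hilbert f x) -
      (\<Sum>j<m. of_real (x ^ (m - Suc j)) * (LINT t|lborel. times_pow j f (x - t))) = ?r"
    by (simp only: integral_reflect mult_ac)
  finally have "(hilbert_truncated (times_pow m f) x \<longlongrightarrow> ?r) (at_right 0)"
  proof (rule Lim_transform_eventually)
    have "\<forall>\<^sub>F \<epsilon> in at_right 0. (0::real) < \<epsilon>" by (rule eventually_at_right_less)
    then show "\<forall>\<^sub>F \<epsilon> in at_right 0. of_real (x ^ m) * hilbert_truncated f x \<epsilon> -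
      (\<Sum>j<m. of_real (x ^ (m - Suc j)) *
        (LINT t|lborel. indicator {t. \<bar>t\<bar> > \<epsilon>} t *\<^sub>R times_pow j f (x - t))) =
      hilbert_truncated (times_pow m f) x \<epsilon>"
      by eventually_elim (simp only: hilbert_truncated_times_pow[OF f(1) fm low])
  qed
  from hilbert_eqI[OF this] show ?thesis by simp
qed

section \<open>Antisymmetry of the truncated transform\<close>

text \<open>The kernel is at most \<open>1 / \<epsilon>\<close> in modulus, so this is the integrability of a product of two
  integrable functions. The sign \<open>c\<close> allows both \<open>v (x - t)\<close> and \<open>v (x + t)\<close>, the two forms that
  appear on the two sides of Fubini's theorem.\<close>
lemma truncated_product_integrable:
  fixes u v :: "real \<Rightarrow> complex"
  assumes u: "integrable lborel u" and v: "integrable lborel v" and "\<epsilon> > 0" and c: "\<bar>c\<bar> = 1"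
  shows "integrable (lborel \<Otimes>\<^sub>M lborel)
    (\<lambda>(x, t). u x * (indicator {t. \<bar>t\<bar> > \<epsilon>} t *\<^sub>R (v (x + c * t) / of_real t)))"
proof (rule lborel_pair.Fubini_integrable)
  note [measurable] = borel_measurable_integrable[OF u] borel_measurable_integrable[OF v]
  let ?F = "\<lambda>x t. u x * (indicator {t. \<bar>t\<bar> > \<epsilon>} t *\<^sub>R (v (x + c * t) / of_real t))"
  show m: "(\<lambda>(x, t). ?F x t) \<in> borel_measurable (lborel \<Otimes>\<^sub>M lborel)"
    by measurable
  have le: "cmod (?F x t) \<le> cmod (u x) * (cmod (v (x + c * t)) / \<epsilon>)" for x t
    using \<open>\<epsilon> > 0\<close> by (auto simp: norm_mult norm_divide indicator_def intro!: mult_left_mono divide_left_mono)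
  have vint: "integrable lborel (\<lambda>t. cmod (v (x + c * t)) / \<epsilon>)" for x
    using integrable_affine_iff[OF c, of v x] v by auto
  have int: "integrable lborel (?F x)" for x
    by (rule Bochner_Integration.integrable_bound[OF integrable_mult_right[OF vint, of "cmod (u x)" x]])
       (use le \<open>\<epsilon> > 0\<close> in \<open>auto simp: mult.assoc\<close>)
  then show "AE x in lborel. integrable lborel (\<lambda>t. case (x, t) of (x, t) \<Rightarrow> ?F x t)"
    by simp
  show "integrable lborel (\<lambda>x. LINT t|lborel. norm (case (x, t) of (x, t) \<Rightarrow> ?F x t))"
  proof (rule Bochner_Integration.integrable_bound)
    show "integrable lborel (\<lambda>x. cmod (u x) * ((LINT t|lborel. cmod (v t)) / \<epsilon>))"
      using u by auto
    show "(\<lambda>x. LINT t|lborel. norm (case (x, t) of (x, t) \<Rightarrow> ?F x t)) \<in> borel_measurable lborel"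
      by measurable
    have "(LINT t|lborel. cmod (?F x t)) \<le> cmod (u x) * ((LINT t|lborel. cmod (v t)) / \<epsilon>)" for x
    proof -
      have "(LINT t|lborel. cmod (?F x t)) \<le> (LINT t|lborel. cmod (u x) * (cmod (v (x + c * t)) / \<epsilon>))"
        by (rule integral_mono[OF integrable_norm[OF int] integrable_mult_right[OF vint] le])
      also have "\<dots> = cmod (u x) * ((LINT t|lborel. cmod (v (x + c * t))) / \<epsilon>)"
        by simp
      also have "(LINT t|lborel. cmod (v (x + c * t))) = (LINT t|lborel. cmod (v t))"
        using integral_affine[OF c] .
      finally show ?thesis .
    qed
    then show "AE x in lborel. norm (LINT t|lborel. norm (case (x, t) of (x, t) \<Rightarrow> ?F x t)) \<le>
        norm (cmod (u x) * ((LINT t|lborel. cmod (v t)) / \<epsilon>))"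
      using \<open>\<epsilon> > 0\<close> by simp
  qed
qed

lemma hilbert_truncated_reflect:
  "hilbert_truncated f x \<epsilon> = - (LINT t|lborel. indicator {t. \<bar>t\<bar> > \<epsilon>} t *\<^sub>R (f (x + t) / of_real t))"
proof -
  let ?h = "\<lambda>t. indicator {t. \<bar>t\<bar> > \<epsilon>} t *\<^sub>R (f (x - t) / of_real t)"
  have "hilbert_truncated f x \<epsilon> = (LINT t|lborel. ?h (0 - t))"
    unfolding hilbert_truncated_eq by (rule integral_reflect[symmetric])
  also have "\<dots> = (LINT t|lborel. - (indicator {t. \<bar>t\<bar> > \<epsilon>} t *\<^sub>R (f (x + t) / of_real t)))"
    by (rule Bochner_Integration.integral_cong) (auto simp: indicator_def)
  finally show ?thesis by simp
qed

text \<open>Fubini's theorem and the translation \<open>x = y + t\<close> in the inner integral; the sign comes from the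
  oddness of the kernel (\<open>hilbert_truncated_reflect\<close>).\<close>
lemma hilbert_truncated_antisymmetric:
  fixes u v :: "real \<Rightarrow> complex"
  assumes u: "integrable lborel u" and v: "integrable lborel v" and \<epsilon>: "\<epsilon> > 0"
  shows "(LINT x|lborel. u x * hilbert_truncated v x \<epsilon>) =
    - (LINT y|lborel. v y * hilbert_truncated u y \<epsilon>)"
proof -
  let ?I = "\<lambda>t. indicat_real {t. \<bar>t\<bar> > \<epsilon>} t"
  let ?J = "\<lambda>x t. u x * (?I t *\<^sub>R (v (x - t) / of_real t))"
  let ?K = "\<lambda>y t. v y * (?I t *\<^sub>R (u (y + t) / of_real t))"
  have intJ: "integrable (lborel \<Otimes>\<^sub>M lborel) (\<lambda>(x, t). ?J x t)"
    using truncated_product_integrable[OF u v \<epsilon>, of "-1"] by simp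
  have intK: "integrable (lborel \<Otimes>\<^sub>M lborel) (\<lambda>(y, t). ?K y t)"
    using truncated_product_integrable[OF v u \<epsilon>, of 1] by simp
  have swap: "(LINT x|lborel. ?J x t) = (LINT y|lborel. ?K y t)" for t
    using integral_affine[of 1 "\<lambda>x. ?J x t" t, symmetric] by (simp add: mult_ac add.commute)
  have "(LINT x|lborel. u x * hilbert_truncated v x \<epsilon>) = (LINT x|lborel. LINT t|lborel. ?J x t)"
    by (simp only: hilbert_truncated_eq integral_mult_right_zero)
  also have "\<dots> = (LINT t|lborel. LINT x|lborel. ?J x t)"
    by (rule lborel_pair.Fubini_integral[OF intJ, symmetric])
  also have "\<dots> = (LINT t|lborel. LINT y|lborel. ?K y t)"
    by (intro Bochner_Integration.integral_cong refl swap)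
  also have "\<dots> = (LINT y|lborel. LINT t|lborel. ?K y t)"
    by (rule lborel_pair.Fubini_integral[OF intK])
  also have "\<dots> = (LINT y|lborel. - (v y * hilbert_truncated u y \<epsilon>))"
    by (simp only: hilbert_truncated_reflect[of u] integral_mult_right_zero mult_minus_right minus_minus)
  finally show ?thesis by simp
qed

section \<open>The integral of a Hilbert transform\<close>

text \<open>Integrable weights that increase to \<open>1\<close> as \<open>R\<close> grows and whose Hilbert transforms tend to \<open>0\<close>.\<close>
definition cauchy_weight :: "real \<Rightarrow> real \<Rightarrow> real" where
  "cauchy_weight R x = 1 / (1 + (x / R)\<^sup>2)"

lemma cauchy_weight_pos: "0 < cauchy_weight R x"
  and cauchy_weight_le_1: "cauchy_weight R x \<le> 1"
  by (auto simp: cauchy_weight_def divide_le_eq add_pos_nonneg)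

lemma cauchy_weight_measurable [measurable]: "cauchy_weight R \<in> borel_measurable borel"
  unfolding cauchy_weight_def by measurable

lemma cauchy_weight_has_integral:
  assumes "R > 0"
  shows "has_bochner_integral lborel (cauchy_weight R) (R * pi)"
proof -
  have "has_bochner_integral lborel (\<lambda>x::real. inverse (1 + x\<^sup>2)) pi"
    using integrable_inverse_1_plus_square LBINT_inverse_1_plus_square
    by (simp add: has_bochner_integral_iff interval_lebesgue_integral_def set_lebesgue_integral_def
        set_integrable_def)
  then have "has_bochner_integral lborel (\<lambda>x. inverse (1 + (0 + 1 / R * x)\<^sup>2)) (pi /\<^sub>R \<bar>1 / R\<bar>)"
    using assms by (subst (asm) lborel_has_bochner_integral_real_affine_iff[of "1 / R" _ _ 0]) auto
  then show ?thesis
    using assms by (simp add: cauchy_weight_def[abs_def] inverse_eq_divide[abs_def] mult.commute abs_of_pos)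
qed

text \<open>The factor \<open>t\<close> on the right cancels the kernel, and the factor \<open>y / R^2\<close> is the source of the
  smallness: integrating the remaining weight costs only \<open>R\<close>.\<close>
lemma cauchy_weight_diff:
  assumes "R > 0"
  shows "cauchy_weight R (y - t) - cauchy_weight R (y + t) =
    4 * y * t / R\<^sup>2 * cauchy_weight R (y - t) * cauchy_weight R (y + t)"
proof -
  have "1 + ((y - t) / R)\<^sup>2 > 0" "1 + ((y + t) / R)\<^sup>2 > 0" by (auto intro: add_pos_nonneg)
  then show ?thesis
    using assms unfolding cauchy_weight_def
    by (simp add: divide_simps) (simp add: power2_eq_square algebra_simps)
qed

text \<open>Averaging the two forms \<open>w (y - t) / t\<close> and \<open>- w (y + t) / t\<close> of the integrand
  makes \<open>cauchy_weight_diff\<close> applicable. The bound does not depend on \<open>\<epsilon>\<close>.\<close>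
lemma hilbert_truncated_cauchy_weight_bound:
  assumes R: "R > 0" and \<epsilon>: "\<epsilon> > 0"
  shows "cmod (hilbert_truncated (\<lambda>x. of_real (cauchy_weight R x)) y \<epsilon>) \<le> 2 * pi * \<bar>y\<bar> / R"
proof -
  let ?w = "\<lambda>x. complex_of_real (cauchy_weight R x)"
  let ?I = "\<lambda>t. indicat_real {t. \<bar>t\<bar> > \<epsilon>} t"
  have wR: "integrable lborel (cauchy_weight R)" "(LINT x|lborel. cauchy_weight R x) = R * pi"
    using cauchy_weight_has_integral[OF R] by (auto simp: has_bochner_integral_iff)
  have w: "integrable lborel ?w"
    using wR by (intro integrable_of_real)
  have i1: "integrable lborel (\<lambda>t. ?I t *\<^sub>R (?w (y - t) / of_real t))"
    using truncated_integrable[OF w \<epsilon>, of y] by (simp add: set_integrable_def)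
  have i2: "integrable lborel (\<lambda>t. ?I t *\<^sub>R (?w (y + t) / of_real t))"
    using integrable_affine_iff[of "-1" "\<lambda>t. - (?I t *\<^sub>R (?w (y + t) / of_real t))" 0] i1
    by (simp add: indicator_def)
  have i3: "integrable lborel (\<lambda>t. cauchy_weight R (y + t))"
    using lborel_integrable_real_affine_iff[of 1 "cauchy_weight R" y] wR by simp
  have "2 * hilbert_truncated ?w y \<epsilon> =
      (LINT t|lborel. ?I t *\<^sub>R (?w (y - t) / of_real t)) - (LINT t|lborel. ?I t *\<^sub>R (?w (y + t) / of_real t))"
    using hilbert_truncated_eq[of ?w y \<epsilon>] hilbert_truncated_reflect[of ?w y \<epsilon>] by simp
  also have "\<dots> = (LINT t|lborel. ?I t *\<^sub>R (?w (y - t) / of_real t) - ?I t *\<^sub>R (?w (y + t) / of_real t))"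
    using i1 i2 by simp
  finally have "cmod (2 * hilbert_truncated ?w y \<epsilon>) \<le>
      (LINT t|lborel. cmod (?I t *\<^sub>R (?w (y - t) / of_real t) - ?I t *\<^sub>R (?w (y + t) / of_real t)))"
    by (simp only: integral_norm_bound)
  also have "\<dots> \<le> (LINT t|lborel. 4 * \<bar>y\<bar> / R\<^sup>2 * cauchy_weight R (y + t))"
  proof (rule integral_mono)
    fix t
    show "cmod (?I t *\<^sub>R (?w (y - t) / of_real t) - ?I t *\<^sub>R (?w (y + t) / of_real t))
        \<le> 4 * \<bar>y\<bar> / R\<^sup>2 * cauchy_weight R (y + t)"
    proof (cases "\<bar>t\<bar> > \<epsilon>")
      case True
      then have t: "t \<noteq> 0" using \<epsilon> by auto
      have "?I t *\<^sub>R (?w (y - t) / of_real t) - ?I t *\<^sub>R (?w (y + t) / of_real t) =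
          of_real ((cauchy_weight R (y - t) - cauchy_weight R (y + t)) / t)"
        using True by (simp add: diff_divide_distrib)
      also have "\<dots> = of_real (4 * y / R\<^sup>2 * cauchy_weight R (y - t) * cauchy_weight R (y + t))"
        using t by (simp add: cauchy_weight_diff[OF R])
      also have "cmod \<dots> = 4 * \<bar>y\<bar> / R\<^sup>2 * cauchy_weight R (y - t) * cauchy_weight R (y + t)"
        using cauchy_weight_pos[of R] by (simp only: norm_of_real) (simp add: abs_mult less_imp_le)
      also have "\<dots> \<le> 4 * \<bar>y\<bar> / R\<^sup>2 * 1 * cauchy_weight R (y + t)"
        using cauchy_weight_pos[of R] cauchy_weight_le_1[of R]
        by (intro mult_right_mono mult_left_mono) (auto simp: less_imp_le)
      finally show ?thesis by simp
    qed (use cauchy_weight_pos[of R] in \<open>simp add: less_imp_le\<close>)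
  qed (use i1 i2 i3 in auto)
  also have "\<dots> = 4 * \<bar>y\<bar> / R\<^sup>2 * (R * pi)"
    using integral_affine[of 1 "cauchy_weight R" y] wR by simp
  finally show ?thesis
    using R by (simp add: norm_mult power2_eq_square field_simps)
qed

text \<open>By antisymmetry the truncated transform can be moved onto the weight, where the previous bound
  holds for all \<open>\<epsilon>\<close>; the limit \<open>\<epsilon> \<rightarrow> 0\<close> is dominated thanks to the uniform bound on the truncated
  transform of \<open>f\<close>.\<close>
lemma hilbert_cauchy_weight_integral_bound:
  assumes f: "integrable lborel f" and lip: "L-lipschitz_on UNIV f"
    and yf: "integrable lborel (times_pow 1 f)" and R: "R > 0"
  shows "cmod (LINT x|lborel. of_real (cauchy_weight R x) * hilbert f x)
    \<le> 2 / R * (LINT y|lborel. cmod (times_pow 1 f y))"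
proof -
  let ?w = "\<lambda>x. complex_of_real (cauchy_weight R x)"
  let ?e = "\<lambda>m. inverse (real (Suc m))"
  let ?B = "2 * L + (LINT t|lborel. cmod (f t))"
  have wR: "integrable lborel (cauchy_weight R)"
    using cauchy_weight_has_integral[OF R] by (auto simp: has_bochner_integral_iff)
  have w: "integrable lborel ?w"
    using wR by (intro integrable_of_real)
  have fm: "f \<in> borel_measurable borel" using f by auto
  note [measurable] = hilbert_truncated_measurable[OF fm] hilbert_measurable[OF f lip]
  have bound: "cmod (LINT x|lborel. ?w x * hilbert_truncated f x \<epsilon>) \<le>
      2 * pi / R * (LINT y|lborel. cmod (times_pow 1 f y))" if \<epsilon>: "\<epsilon> > 0" for \<epsilon>
  proof -
    have le: "cmod (f y * hilbert_truncated ?w y \<epsilon>) \<le> 2 * pi / R * cmod (times_pow 1 f y)" for y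
      using mult_left_mono[OF hilbert_truncated_cauchy_weight_bound[OF R \<epsilon>, of y], of "cmod (f y)"]
      by (simp add: norm_mult times_pow_def mult_ac)
    have "cmod (LINT x|lborel. ?w x * hilbert_truncated f x \<epsilon>) =
        cmod (LINT y|lborel. f y * hilbert_truncated ?w y \<epsilon>)"
      unfolding hilbert_truncated_antisymmetric[OF w f \<epsilon>] by simp
    also have "\<dots> \<le> (LINT y|lborel. 2 * pi / R * cmod (times_pow 1 f y))"
      by (rule order_trans[OF integral_norm_bound integral_mono']) (use R yf le in auto)
    finally show ?thesis by simp
  qed
  have *: "filterlim ?e (at_right 0) sequentially"
    by (intro filterlim_compose[OF filterlim_inverse_at_right_top]
        filterlim_compose[OF filterlim_real_sequentially] filterlim_Suc)
  have "(\<lambda>m. LINT x|lborel. ?w x * hilbert_truncated f x (?e m)) \<longlonglongrightarrow>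
      (LINT x|lborel. ?w x * (of_real pi * hilbert f x))"
  proof (rule integral_dominated_convergence[where w = "\<lambda>x. cauchy_weight R x * ?B"])
    show "integrable lborel (\<lambda>x. cauchy_weight R x * ?B)" using wR by auto
    show "AE x in lborel. (\<lambda>m. ?w x * hilbert_truncated f x (?e m)) \<longlonglongrightarrow> ?w x * (of_real pi * hilbert f x)"
      by (intro AE_I2 tendsto_mult_left filterlim_compose[OF hilbert_truncated_tendsto[OF f lip] *])
    show "AE x in lborel. norm (?w x * hilbert_truncated f x (?e m)) \<le> cauchy_weight R x * ?B" for m
    proof (rule AE_I2)
      fix x
      have "?e m \<le> 1" by (simp add: inverse_le_1_iff)
      then have "cauchy_weight R x * cmod (hilbert_truncated f x (?e m)) \<le> cauchy_weight R x * ?B"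
        using cauchy_weight_pos[of R x] by (intro mult_left_mono hilbert_truncated_bound[OF f lip]) auto
      then show "norm (?w x * hilbert_truncated f x (?e m)) \<le> cauchy_weight R x * ?B"
        using cauchy_weight_pos[of R x] by (simp add: norm_mult)
    qed
  qed measurable
  from tendsto_norm[OF this] have "cmod (LINT x|lborel. ?w x * (of_real pi * hilbert f x)) \<le>
      2 * pi / R * (LINT y|lborel. cmod (times_pow 1 f y))"
    by (rule LIMSEQ_le_const2) (intro exI allI impI bound, simp)
  also have "(LINT x|lborel. ?w x * (of_real pi * hilbert f x)) =
      of_real pi * (LINT x|lborel. ?w x * hilbert f x)"
    by (simp only: mult.left_commute[of _ "of_real pi"] integral_mult_right_zero)
  finally show ?thesis
    using R by (simp add: norm_mult field_simps)
qed

text \<open>Let \<open>R \<rightarrow> \<infinity>\<close> in the previous lemma: the weights tend to \<open>1\<close> and the right-hand side to \<open>0\<close>.\<close>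
theorem hilbert_integral_eq_0:
  assumes f: "integrable lborel f" and lip: "L-lipschitz_on UNIV f"
    and yf: "integrable lborel (times_pow 1 f)" and H: "integrable lborel (hilbert f)"
  shows "(LINT x|lborel. hilbert f x) = 0"
proof -
  let ?w = "\<lambda>m x. complex_of_real (cauchy_weight (real (Suc m)) x)"
  note [measurable] = borel_measurable_integrable[OF H]
  have *: "filterlim (\<lambda>m. real (Suc m)) at_top sequentially"
    by (intro filterlim_compose[OF filterlim_real_sequentially] filterlim_Suc)
  have w1: "(\<lambda>m. ?w m x) \<longlonglongrightarrow> 1" for x
  proof -
    have "((\<lambda>R. complex_of_real (cauchy_weight R x)) \<longlongrightarrow> of_real (1 / (1 + 0\<^sup>2))) at_top"
      unfolding cauchy_weight_def by (intro tendsto_intros tendsto_divide_0[OF tendsto_const] filterlim_at_top_imp_at_infinity filterlim_ident) auto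
    from filterlim_compose[OF this *] show ?thesis by simp
  qed
  have "(\<lambda>m. LINT x|lborel. ?w m x * hilbert f x) \<longlonglongrightarrow> (LINT x|lborel. hilbert f x)"
  proof (rule integral_dominated_convergence[where w = "\<lambda>x. cmod (hilbert f x)"])
    show "AE x in lborel. (\<lambda>m. ?w m x * hilbert f x) \<longlonglongrightarrow> hilbert f x"
      using tendsto_mult_right[OF w1] by simp
    show "AE x in lborel. norm (?w m x * hilbert f x) \<le> cmod (hilbert f x)" for m
      using cauchy_weight_pos[of "real (Suc m)"] cauchy_weight_le_1[of "real (Suc m)"]
      by (intro AE_I2) (simp add: norm_mult abs_of_pos mult_left_le_one_le less_imp_le del: of_nat_Suc)
  qed (use H in \<open>auto simp del: of_nat_Suc\<close>)
  moreover have "(\<lambda>m. LINT x|lborel. ?w m x * hilbert f x) \<longlonglongrightarrow> 0"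
  proof (rule Lim_null_comparison)
    show "\<forall>\<^sub>F m in sequentially. cmod (LINT x|lborel. ?w m x * hilbert f x)
        \<le> 2 / real (Suc m) * (LINT y|lborel. cmod (times_pow 1 f y))"
      by (intro always_eventually allI hilbert_cauchy_weight_integral_bound[OF f lip yf]) simp
    show "(\<lambda>m. 2 / real (Suc m) * (LINT y|lborel. cmod (times_pow 1 f y))) \<longlonglongrightarrow> 0"
      by (intro tendsto_mult_left_zero tendsto_divide_0[OF tendsto_const] filterlim_at_top_imp_at_infinity *)
  qed
  ultimately show ?thesis by (rule LIMSEQ_unique)
qed

section \<open>Interpolation between powers\<close>

lemma lipschitz_of_vector_derivative_bound:
  fixes f :: "real \<Rightarrow> 'a::real_normed_vector"
  assumes "\<And>x. f differentiable (at x)" "\<And>x. norm (vector_derivative f (at x)) \<le> M"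
  shows "M-lipschitz_on UNIV f"
proof (rule lipschitz_onI)
  have d: "(f has_derivative (\<lambda>h. h *\<^sub>R vector_derivative f (at x))) (at x within UNIV)" for x
    using assms(1)[of x] by (simp add: vector_derivative_works has_vector_derivative_def)
  have o: "onorm (\<lambda>h::real. h *\<^sub>R vector_derivative f (at x)) \<le> M" for x
    using assms(2)[of x] by (intro onorm_le) (auto simp: mult.commute[of M] intro!: mult_left_mono)
  show "dist (f x) (f y) \<le> M * dist x y" for x y
    using differentiable_bound[OF convex_UNIV d o, of x y] by (simp add: dist_norm)
  show "0 \<le> M"
    using assms(2)[of 0] norm_ge_zero order_trans by blast
qed

text \<open>Average \<open>\<bar>f x\<bar> \<le> \<bar>f t\<bar> + L \<bar>x - t\<bar>\<close> over \<open>t\<close> in \<open>{x..x + 1}\<close>.\<close>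
lemma integrable_lipschitz_bound:
  fixes f :: "real \<Rightarrow> complex"
  assumes f: "integrable lborel f" and lip: "L-lipschitz_on UNIV f"
  shows "cmod (f x) \<le> L + (LINT t|lborel. cmod (f t))"
proof -
  let ?I = "indicat_real {x..x + 1}"
  have L: "L \<ge> 0" using lip by (rule lipschitz_on_nonneg)
  have "(LINT t|lborel. ?I t * cmod (f x)) \<le> (LINT t|lborel. ?I t * L + cmod (f t))"
  proof (rule integral_mono)
    fix t
    show "?I t * cmod (f x) \<le> ?I t * L + cmod (f t)"
    proof (cases "t \<in> {x..x + 1}")
      case True
      have "cmod (f x) \<le> cmod (f t) + cmod (f x - f t)"
        by (rule norm_triangle_sub)
      also have "cmod (f x - f t) \<le> L * \<bar>x - t\<bar>"
        using lipschitz_onD[OF lip, of x t] by (simp add: dist_norm)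
      also have "\<dots> \<le> L * 1"
        using True L by (intro mult_left_mono) auto
      finally show ?thesis using True by simp
    qed simp
  qed (use f in auto)
  also have "\<dots> = L + (LINT t|lborel. cmod (f t))"
    using f by (subst Bochner_Integration.integral_add) auto
  finally show ?thesis by simp
qed

lemma power_le_one_plus_power:
  fixes a :: real
  assumes "0 \<le> a" "j \<le> m"
  shows "a ^ j \<le> 1 + a ^ m"
proof (cases "a \<le> 1")
  case True
  then show ?thesis using assms power_le_one[of a j] zero_le_power[of a m] by linarith
next
  case False
  then show ?thesis using assms power_increasing[of j m a] by linarith
qed

lemma cmod_times_pow: "cmod (times_pow m f x) = \<bar>x\<bar> ^ m * cmod (f x)"
  by (simp add: times_pow_def norm_mult norm_power)

lemma cmod_times_pow_le:
  assumes "j \<le> m"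
  shows "cmod (times_pow j f x) \<le> cmod (f x) + cmod (times_pow m f x)"
  using mult_right_mono[OF power_le_one_plus_power[OF abs_ge_zero[of x] assms], of "cmod (f x)"]
  by (simp add: cmod_times_pow algebra_simps)

lemma times_pow_measurable:
  assumes [measurable]: "f \<in> borel_measurable borel"
  shows "times_pow m f \<in> borel_measurable borel"
  unfolding times_pow_def by measurable

lemma times_pow_integrable:
  assumes f: "integrable lborel f" "integrable lborel (times_pow m f)" and "j \<le> m"
  shows "integrable lborel (times_pow j f)"
proof (rule Bochner_Integration.integrable_bound)
  show "integrable lborel (\<lambda>x. cmod (f x) + cmod (times_pow m f x))"
    using f by auto
  show "times_pow j f \<in> borel_measurable lborel"
    using times_pow_measurable[of f] f by simp
  show "AE x in lborel. cmod (times_pow j f x) \<le> norm (cmod (f x) + cmod (times_pow m f x))"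
    using cmod_times_pow_le[OF assms(3)] by simp
qed

lemma times_pow_has_vector_derivative:
  assumes "f differentiable (at x)"
  shows "(times_pow k f has_vector_derivative
    of_real (real k * x ^ (k - 1)) * f x + of_real (x ^ k) * vector_derivative f (at x)) (at x)"
proof -
  have d: "((\<lambda>x. complex_of_real (x ^ k)) has_vector_derivative of_real (real k * x ^ (k - 1))) (at x)"
    by (rule has_vector_derivative_of_real)
       (auto intro!: derivative_eq_intros simp: has_real_derivative_iff_has_vector_derivative[symmetric])
  show ?thesis
    unfolding times_pow_def[abs_def]
    using has_vector_derivative_mult[OF d assms[unfolded vector_derivative_works]] by (simp add: add.commute)
qed

text \<open>By the product rule \<open>(x^k f)' = k x^(k - 1) f + x^k f'\<close>. Both \<open>f\<close> and \<open>x^m f\<close> are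
  bounded, being integrable and Lipschitz, hence so are all \<open>x^j f\<close> with \<open>j \<le> m\<close>. For \<open>k = m\<close> the
  product rule then bounds \<open>x^m f'\<close>, and \<open>x^k f'\<close> lies between \<open>f'\<close> and \<open>x^m f'\<close>.\<close>
lemma times_pow_lipschitz:
  assumes diff: "\<And>x. f differentiable (at x)"
    and f: "integrable lborel f" "L-lipschitz_on UNIV f" "\<And>x. cmod (vector_derivative f (at x)) \<le> L"
    and fm: "integrable lborel (times_pow m f)" "K-lipschitz_on UNIV (times_pow m f)"
      "\<And>x. cmod (vector_derivative (times_pow m f) (at x)) \<le> K"
    and "k \<le> m"
  shows "\<exists>M. M-lipschitz_on UNIV (times_pow k f)"
proof -
  obtain B where B: "\<And>x j. j \<le> m \<Longrightarrow> cmod (times_pow j f x) \<le> B"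
    using order_trans[OF cmod_times_pow_le add_mono[OF integrable_lipschitz_bound[OF f(1,2)] integrable_lipschitz_bound[OF fm(1,2)]]]
    by meson
  define d where "d = (\<lambda>x. vector_derivative f (at x))"
  have vd: "vector_derivative (times_pow j f) (at x) = of_real (real j) * times_pow (j - 1) f x + times_pow j d x" for j x
    using vector_derivative_at[OF times_pow_has_vector_derivative[OF diff]]
    by (simp add: times_pow_def d_def mult.assoc)
  have low: "cmod (of_real (real j) * times_pow (j - 1) f x) \<le> real j * B" if "j \<le> m" for j x
    using that B[of "j - 1" x] by (auto simp: norm_mult intro!: mult_left_mono)
  \<comment> \<open>the product rule for \<open>k = m\<close>, solved for \<open>x^m f'\<close>\<close>
  have top: "cmod (times_pow m d x) \<le> K + real m * B" for x
  proof -
    have "times_pow m d x = vector_derivative (times_pow m f) (at x) - of_real (real m) * times_pow (m - 1) f x"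
      using vd by simp
    then show ?thesis
      using norm_triangle_ineq4[of "vector_derivative (times_pow m f) (at x)" "of_real (real m) * times_pow (m - 1) f x"]
        fm(3)[of x] low[of m x] by simp
  qed
  have "cmod (vector_derivative (times_pow k f) (at x)) \<le> real k * B + (L + (K + real m * B))" for x
    unfolding vd
    by (rule order_trans[OF norm_triangle_ineq add_mono[OF low[OF \<open>k \<le> m\<close>]
       order_trans[OF cmod_times_pow_le[OF \<open>k \<le> m\<close>] add_mono[OF _ top]]]]) (simp add: d_def f(3))
  then show ?thesis
    using lipschitz_of_vector_derivative_bound[of "times_pow k f"]
      differentiableI_vector[OF times_pow_has_vector_derivative[OF diff]] by blast
qed

section \<open>Norms as real numbers\<close>

lemma norm_L1_finite:
  assumes "f \<in> borel_measurable borel" "norm_L1 f < \<infinity>"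
  shows "integrable lborel f" "norm_L1 f = ennreal (LINT x|lborel. cmod (f x))"
proof -
  show "integrable lborel f"
    using assms by (intro integrableI_bounded) (auto simp: norm_L1_def)
  then show "norm_L1 f = ennreal (LINT x|lborel. cmod (f x))"
    unfolding norm_L1_def by (intro nn_integral_eq_integral) auto
qed

lemma norm_sup_finite:
  assumes "norm_sup f < \<infinity>"
  obtains M where "M \<ge> 0" "norm_sup f = ennreal M" "\<And>x. cmod (f x) \<le> M"
proof -
  obtain M where M: "M \<ge> 0" "norm_sup f = ennreal M"
    using assms by (cases "norm_sup f" rule: ennreal_cases) auto
  have "ennreal (cmod (f x)) \<le> ennreal M" for x
    unfolding M(2)[symmetric] norm_sup_def by (rule SUP_upper) simp
  with M show ?thesis
    using that by simp
qed

lemma norm_1inf_finite: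
  assumes diff: "\<And>x. f differentiable (at x)" and fin: "norm_1inf f < \<infinity>"
  obtains M where "M \<ge> 0" "norm_1inf f = ennreal ((LINT x|lborel. cmod (f x)) + M)"
    "\<And>x. cmod (vector_derivative f (at x)) \<le> M" "M-lipschitz_on UNIV f" "integrable lborel f"
proof -
  have "continuous_on UNIV f"
    using diff by (auto intro!: continuous_at_imp_continuous_on differentiable_imp_continuous_within)
  then have m: "f \<in> borel_measurable borel" by (rule borel_measurable_continuous_onI)
  have 1: "norm_L1 f < \<infinity>" and 2: "norm_sup (\<lambda>x. vector_derivative f (at x)) < \<infinity>"
    using fin unfolding norm_1inf_def by (auto simp: less_top[symmetric])
  obtain M where M: "M \<ge> 0" "norm_sup (\<lambda>x. vector_derivative f (at x)) = ennreal M"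
      "\<And>x. cmod (vector_derivative f (at x)) \<le> M"
    using norm_sup_finite[OF 2] by blast
  show ?thesis
  proof (rule that[OF M(1) _ M(3)])
    show "norm_1inf f = ennreal ((LINT x|lborel. cmod (f x)) + M)"
      unfolding norm_1inf_def norm_L1_finite(2)[OF m 1] M(2) using M(1) by (simp add: ennreal_plus)
    show "M-lipschitz_on UNIV f"
      by (rule lipschitz_of_vector_derivative_bound[OF diff M(3)])
    show "integrable lborel f" by (rule norm_L1_finite(1)[OF m 1])
  qed
qed

section \<open>Decay and vanishing moments\<close>

text \<open>Multiplied by \<open>\<pi>\<close>, the uniform bound for \<open>\<psi>\<close> controls \<open>\<bar>H \<psi> x\<bar>\<close>, and the one for
  \<open>x^(n+1) \<psi>\<close> together with the moment of order \<open>n\<close> controls \<open>\<bar>x\<bar>^(n+1) \<bar>H \<psi> x\<bar>\<close>. The factor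
  \<open>2\<close> in front of the Lipschitz constants is absorbed by \<open>\<pi> \<ge> 2\<close>.\<close>
lemma hilbert_decay:
  assumes van: "vanishing_moments n \<psi>"
    and f: "integrable lborel \<psi>" "L-lipschitz_on UNIV \<psi>"
    and fm: "integrable lborel (times_pow (n + 1) \<psi>)" "K-lipschitz_on UNIV (times_pow (n + 1) \<psi>)"
  shows "cmod (hilbert \<psi> x) \<le> (((LINT x|lborel. cmod (\<psi> x)) + L) +
      ((LINT x|lborel. cmod (times_pow (n + 1) \<psi> x)) + K) +
      (LINT x|lborel. cmod (times_pow n \<psi> x))) / (1 + \<bar>x\<bar> ^ (n + 1))"
    (is "_ \<le> ((?a + L) + (?b + K) + ?c) / _")
proof -
  have LK: "L \<ge> 0" "K \<ge> 0"
    using f fm lipschitz_on_nonneg by blast+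
  have nn: "?a \<ge> 0" "?b \<ge> 0" "?c \<ge> 0" by auto
  let ?H = "hilbert \<psi> x"
  have "(\<Sum>j<n + 1. of_real (x ^ (n + 1 - Suc j)) * (LINT t|lborel. times_pow j \<psi> t)) =
      (LINT t|lborel. times_pow n \<psi> t)"
    using van by (simp add: vanishing_moments_def)
  then have "of_real pi * hilbert (times_pow (n + 1) \<psi>) x =
      of_real pi * of_real (x ^ (n + 1)) * ?H - (LINT t|lborel. times_pow n \<psi> t)"
    using hilbert_times_pow[OF f fm(1) times_pow_integrable[OF f(1) fm(1)], of x] by simp
  then have "of_real pi * of_real (x ^ (n + 1)) * ?H =
      of_real pi * hilbert (times_pow (n + 1) \<psi>) x + (LINT t|lborel. times_pow n \<psi> t)"
    by simp
  then have "cmod (of_real pi * of_real (x ^ (n + 1)) * ?H) \<le>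
      cmod (of_real pi * hilbert (times_pow (n + 1) \<psi>) x) + cmod (LINT t|lborel. times_pow n \<psi> t)"
    by (simp only: norm_triangle_ineq)
  also have "\<dots> \<le> (2 * K + ?b) + ?c"
    using hilbert_bound[OF fm, of x] by (intro add_mono integral_norm_bound) (simp add: norm_mult)
  \<comment> \<open>the regime of large \<open>\<bar>x\<bar>\<close>; \<open>near\<close> below is the one of small \<open>\<bar>x\<bar>\<close>\<close>
  finally have far: "pi * (\<bar>x\<bar> ^ (n + 1) * cmod ?H) \<le> 2 * K + ?b + ?c"
    by (simp add: norm_mult norm_power)
  have near: "pi * cmod ?H \<le> 2 * L + ?a"
    by (rule hilbert_bound[OF f])
  have "2 * ((1 + \<bar>x\<bar> ^ (n + 1)) * cmod ?H) \<le> pi * ((1 + \<bar>x\<bar> ^ (n + 1)) * cmod ?H)"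
    using pi_ge_two by (intro mult_right_mono mult_nonneg_nonneg add_nonneg_nonneg) auto
  also have "\<dots> \<le> (2 * L + ?a) + (2 * K + ?b + ?c)"
    using near far by (simp add: algebra_simps)
  finally have "(1 + \<bar>x\<bar> ^ (n + 1)) * cmod ?H \<le> (?a + L) + (?b + K) + ?c"
    using nn LK by linarith
  then show ?thesis
    by (simp add: pos_le_divide_eq add_pos_nonneg mult.commute)
qed

text \<open>Compare with \<open>2 D / (1 + x^2)\<close>, using that \<open>k\<close> and \<open>k + 2\<close> are both at most \<open>n + 1\<close>.\<close>
lemma decay_times_pow_integrable:
  fixes g :: "real \<Rightarrow> complex"
  assumes m: "g \<in> borel_measurable borel" and "k < n"
    and le: "\<And>x. cmod (g x) \<le> D / (1 + \<bar>x\<bar> ^ (n + 1))"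
  shows "integrable lborel (times_pow k g)"
proof (rule Bochner_Integration.integrable_bound)
  show "integrable lborel (\<lambda>x. 2 * D * cauchy_weight 1 x)"
    using cauchy_weight_has_integral[of 1] by (auto simp: has_bochner_integral_iff)
  show "times_pow k g \<in> borel_measurable lborel"
    using times_pow_measurable[OF m] by simp
  have "cmod (times_pow k g x) \<le> 2 * D * cauchy_weight 1 x" for x
  proof -
    let ?p = "1 + \<bar>x\<bar> ^ (n + 1)"
    have p: "?p > 0" by (simp add: add_pos_nonneg)
    have "0 \<le> D / ?p" using le[of x] norm_ge_zero order_trans by blast
    then have D: "D \<ge> 0" using p by (simp add: zero_le_divide_iff)
    have "\<bar>x\<bar> ^ k * (1 + x\<^sup>2) = \<bar>x\<bar> ^ k + \<bar>x\<bar> ^ (k + 2)"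
      by (simp add: algebra_simps power2_eq_square)
    also have "\<dots> \<le> ?p + ?p"
      using \<open>k < n\<close> by (intro add_mono[of "\<bar>x\<bar> ^ k"] power_le_one_plus_power) linarith+
    finally have "\<bar>x\<bar> ^ k * (1 + x\<^sup>2) \<le> 2 * ?p" by simp
    then have q: "\<bar>x\<bar> ^ k / ?p \<le> 2 / (1 + x\<^sup>2)"
      using p by (simp add: divide_simps add_pos_nonneg mult.commute)
    have "cmod (times_pow k g x) \<le> \<bar>x\<bar> ^ k * (D / ?p)"
      unfolding cmod_times_pow by (intro mult_left_mono le) auto
    also have "\<dots> = D * (\<bar>x\<bar> ^ k / ?p)" by simp
    also have "\<dots> \<le> D * (2 / (1 + x\<^sup>2))"
      by (intro mult_left_mono q D)
    finally show ?thesis by (simp add: cauchy_weight_def mult.commute[of D 2])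
  qed
  then show "AE x in lborel. norm (times_pow k g x) \<le> norm (2 * D * cauchy_weight 1 x)"
    by (intro AE_I2) (auto intro: order_trans[OF _ abs_ge_self])
qed

lemma hilbert_times_pow_vanishing:
  assumes van: "vanishing_moments n \<psi>" and "k < n"
    and f: "integrable lborel \<psi>" "L-lipschitz_on UNIV \<psi>"
  shows "hilbert (times_pow k \<psi>) = times_pow k (hilbert \<psi>)"
proof
  fix x
  have "of_real pi * hilbert (times_pow k \<psi>) x = of_real pi * of_real (x ^ k) * hilbert \<psi> x"
    using van \<open>k < n\<close> by (subst hilbert_times_pow[OF f]) (auto simp: vanishing_moments_def)
  then show "hilbert (times_pow k \<psi>) x = times_pow k (hilbert \<psi>) x"
    by (simp add: times_pow_def)
qed

lemma decay_bigo:
  fixes g :: "real \<Rightarrow> complex"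
  assumes le: "\<And>x. cmod (g x) \<le> D / (1 + \<bar>x\<bar> ^ m)"
  shows "g \<in> O[at_infinity](\<lambda>x. of_real (1 / \<bar>x\<bar> ^ m))"
proof (rule bigoI[where c = D])
  have "cmod (g x) \<le> D * norm (complex_of_real (1 / \<bar>x\<bar> ^ m))" if "norm x \<ge> 1" for x
  proof -
    have p: "\<bar>x\<bar> ^ m > 0" using that by auto
    have "0 \<le> D / (1 + \<bar>x\<bar> ^ m)" using le[of x] norm_ge_zero order_trans by blast
    then have "D \<ge> 0" using p by (simp add: zero_le_divide_iff)
    then have "D / (1 + \<bar>x\<bar> ^ m) \<le> D / \<bar>x\<bar> ^ m"
      using p by (intro divide_left_mono mult_pos_pos add_pos_pos) auto
    then show ?thesis
      using le[of x] by (simp add: norm_divide norm_power)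
  qed
  then show "\<forall>\<^sub>F x in at_infinity. norm (g x) \<le> D * norm (complex_of_real (1 / \<bar>x\<bar> ^ m))"
    unfolding eventually_at_infinity by blast
qed

text \<open>Apply \<open>hilbert_integral_eq_0\<close> to \<open>f = x^k \<psi>\<close>; its hypothesis on \<open>x f = x^(k+1) \<psi>\<close> holds
  because \<open>k + 1 \<le> n + 1\<close>.\<close>
lemma hilbert_vanishing_moments:
  assumes diff: "\<And>x. \<psi> differentiable (at x)"
    and van: "vanishing_moments n \<psi>"
    and f: "integrable lborel \<psi>" "L-lipschitz_on UNIV \<psi>"
      "\<And>x. cmod (vector_derivative \<psi> (at x)) \<le> L"
    and fm: "integrable lborel (times_pow (n + 1) \<psi>)" "K-lipschitz_on UNIV (times_pow (n + 1) \<psi>)"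
      "\<And>x. cmod (vector_derivative (times_pow (n + 1) \<psi>) (at x)) \<le> K"
  shows "vanishing_moments n (hilbert \<psi>)"
  unfolding vanishing_moments_def
proof (intro allI impI)
  fix k assume k: "k < n"
  obtain M where lip: "M-lipschitz_on UNIV (times_pow k \<psi>)"
    using times_pow_lipschitz[OF diff f fm, of k] k by auto
  have int: "integrable lborel (times_pow k \<psi>)"
    using times_pow_integrable[OF f(1) fm(1)] k by simp
  have "integrable lborel (times_pow (k + 1) \<psi>)"
    using times_pow_integrable[OF f(1) fm(1)] k by simp
  then have yint: "integrable lborel (times_pow 1 (times_pow k \<psi>))"
    by (simp add: times_pow_def mult.assoc)
  have H: "integrable lborel (times_pow k (hilbert \<psi>))"
    by (rule decay_times_pow_integrable[OF hilbert_measurable[OF f(1,2)] k hilbert_decay[OF van f(1,2) fm(1,2)]])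
  have eq: "hilbert (times_pow k \<psi>) = times_pow k (hilbert \<psi>)"
    by (rule hilbert_times_pow_vanishing[OF van k f(1,2)])
  show "integrable lborel (times_pow k (hilbert \<psi>)) \<and> (LINT x|lborel. times_pow k (hilbert \<psi>) x) = 0"
    using H hilbert_integral_eq_0[OF int lip yint] unfolding eq by blast
qed

theorem theorem3p2:
  shows "\<exists>C::real. \<forall>n::nat. \<forall>\<psi>::real \<Rightarrow> complex.
    n \<ge> 1 \<longrightarrow>
    (\<forall>x. \<psi> differentiable (at x)) \<longrightarrow>
    vanishing_moments n \<psi> \<longrightarrow>
    norm_1inf \<psi> < \<infinity> \<longrightarrow>
    norm_1inf (times_pow (n + 1) \<psi>) < \<infinity> \<longrightarrow>
    norm_L1 (times_pow n \<psi>) < \<infinity> \<longrightarrow>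
    (\<forall>x. hilbert_well_defined \<psi> x) \<and>
    (\<forall>x. ennreal (cmod (hilbert \<psi> x)) \<le>
       ennreal (C / (1 + \<bar>x\<bar> ^ (n + 1))) *
       (norm_1inf \<psi> + norm_1inf (times_pow (n + 1) \<psi>) + norm_L1 (times_pow n \<psi>))) \<and>
    hilbert \<psi> \<in> O[at_infinity](\<lambda>x. of_real (1 / \<bar>x\<bar> ^ (n + 1))) \<and>
    vanishing_moments n (hilbert \<psi>)"
proof (rule exI[of _ 1], intro allI impI)
  fix n :: nat and \<psi> :: "real \<Rightarrow> complex"
  assume "n \<ge> 1" and diff: "\<forall>x. \<psi> differentiable (at x)" and van: "vanishing_moments n \<psi>"
    and fin: "norm_1inf \<psi> < \<infinity>" "norm_1inf (times_pow (n + 1) \<psi>) < \<infinity>"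
      "norm_L1 (times_pow n \<psi>) < \<infinity>"
  have diff': "times_pow (n + 1) \<psi> differentiable (at x)" for x
    using differentiableI_vector[OF times_pow_has_vector_derivative] diff by blast
  obtain L where L: "L \<ge> 0" "norm_1inf \<psi> = ennreal ((LINT x|lborel. cmod (\<psi> x)) + L)"
      "\<And>x. cmod (vector_derivative \<psi> (at x)) \<le> L" "L-lipschitz_on UNIV \<psi>" "integrable lborel \<psi>"
    using norm_1inf_finite[OF diff[rule_format] fin(1)] by blast
  obtain K where K: "K \<ge> 0"
      "norm_1inf (times_pow (n + 1) \<psi>) = ennreal ((LINT x|lborel. cmod (times_pow (n + 1) \<psi> x)) + K)"
      "\<And>x. cmod (vector_derivative (times_pow (n + 1) \<psi>) (at x)) \<le> K"
      "K-lipschitz_on UNIV (times_pow (n + 1) \<psi>)" "integrable lborel (times_pow (n + 1) \<psi>)"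
    using norm_1inf_finite[OF diff' fin(2)] by blast
  have P: "norm_L1 (times_pow n \<psi>) = ennreal (LINT x|lborel. cmod (times_pow n \<psi> x))"
    using times_pow_measurable[of \<psi> n] L(5) fin(3) by (intro norm_L1_finite) auto
  define D where "D = ((LINT x|lborel. cmod (\<psi> x)) + L) +
      ((LINT x|lborel. cmod (times_pow (n + 1) \<psi> x)) + K) + (LINT x|lborel. cmod (times_pow n \<psi> x))"
  have D: "norm_1inf \<psi> + norm_1inf (times_pow (n + 1) \<psi>) + norm_L1 (times_pow n \<psi>) = ennreal D"
    unfolding L(2) K(2) P D_def using L(1) K(1)
    by (subst ennreal_plus[symmetric]; (intro add_nonneg_nonneg)?; simp)+
  have decay: "cmod (hilbert \<psi> x) \<le> D / (1 + \<bar>x\<bar> ^ (n + 1))" for x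
    unfolding D_def by (rule hilbert_decay[OF van L(5,4) K(5,4)])
  have "ennreal (cmod (hilbert \<psi> x)) \<le> ennreal (1 / (1 + \<bar>x\<bar> ^ (n + 1))) * ennreal D" for x
    using decay[of x] by (subst ennreal_mult'[symmetric]) (auto intro!: ennreal_leI)
  moreover have "hilbert_well_defined \<psi> x" for x
    by (rule hilbert_well_defined_lipschitz[OF L(5,4)])
  ultimately show "(\<forall>x. hilbert_well_defined \<psi> x) \<and>
    (\<forall>x. ennreal (cmod (hilbert \<psi> x)) \<le>
       ennreal (1 / (1 + \<bar>x\<bar> ^ (n + 1))) *
       (norm_1inf \<psi> + norm_1inf (times_pow (n + 1) \<psi>) + norm_L1 (times_pow n \<psi>))) \<and>
    hilbert \<psi> \<in> O[at_infinity](\<lambda>x. of_real (1 / \<bar>x\<bar> ^ (n + 1))) \<and>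
    vanishing_moments n (hilbert \<psi>)"
    unfolding D using decay_bigo[OF decay]
      hilbert_vanishing_moments[OF diff[rule_format] van L(5,4,3) K(5,4,3)] by blast
qed

end
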